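(* Let $A$ and $B$ be maximal monotone operators on $\mathbb R^n$ such that $0\in A(x)+B(x)$ for some $x\in\mathbb R^n$, let $\eta>0$, and let $$T_{\mathrm{DR}}=J_{\eta A}\circ(2J_{\eta B}-I)+I-J_{\eta B}.$$ Take $\mathcal X=\mathbb R^n$, $\nabla h=I$, $\alpha=1$, $\beta=0$, $S=I$, $\Phi=T_{\mathrm{DR}}^{-1}-I$, and $T=(S+\Phi)^{-1}\circ S$. Then the discrete-time TMD iteration $$x_{t+1}=\nabla h^*\big(\nabla h(x_t)+\alpha(S(T(x_t))-S(x_t))-\beta\Phi(x_t)\big)$$ coincides with the Douglas–Rachford splitting iteration $x_{t+1}=T_{\mathrm{DR}}(x_t)$. Moreover, the TMD dynamics with these choices, $$\dot z(t)=\alpha\big(S(T(x(t)))-S(x(t))\big)-\beta\Phi(x(t)),\qquad x(t)=\nabla h^*(z(t)),$$ converge: for every solution defined for $t\ge0$, $x(t)$ converges to a point of $\operatorname{SOL}(\mathbb R^n,\Phi)$, that is, to a fixed point of $T_{\mathrm{DR}}$.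
   Context: $I$ is the identity map on $\mathbb R^n$, and for a maximal monotone (possibly set-valued) operator $X$ on $\mathbb R^n$, $J_X=(I+X)^{-1}$ is its resolvent, a single-valued map $\mathbb R^n\to\mathbb R^n$. $T_{\mathrm{DR}}^{-1}$ is the (possibly set-valued) inverse, so $\Phi(y)=\{x-y: T_{\mathrm{DR}}(x)=y\}$, and $\operatorname{SOL}(\mathbb R^n,\Phi)=\{y:0\in\Phi(y)\}$. Here $h(x)=\frac12\|x\|_2^2$, so $\nabla h^*=I$. The term $\beta\Phi$ is absent since $\beta=0$. The underlying problem is the variational inequality over $\mathbb R^n$ for $F=A+B$ (constraints being absorbed into $A$ or $B$), and the existence of a zero of $A+B$ is the standing assumption that its solution set is nonempty. *)

theory Defs
  imports "HOL-Analysis.Analysis"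
begin

text \<open>
  Set-valued operators are functions into sets; the sum of two values is the Minkowski sum
  of \<open>HOL-Library.Set_Algebras\<close>.
\<close>

definition monotone_operator :: "('a::real_inner \<Rightarrow> 'a set) \<Rightarrow> bool" where
  "monotone_operator X \<longleftrightarrow> (\<forall>x y. \<forall>u\<in>X x. \<forall>v\<in>X y. (u - v) \<bullet> (x - y) \<ge> 0)"

definition maximal_monotone :: "('a::real_inner \<Rightarrow> 'a set) \<Rightarrow> bool" where
  "maximal_monotone X \<longleftrightarrow> monotone_operator X \<and>
     (\<forall>Y. monotone_operator Y \<longrightarrow> (\<forall>x. X x \<subseteq> Y x) \<longrightarrow> Y = X)"

definition scale_operator :: "real \<Rightarrow> ('a \<Rightarrow> 'a set) \<Rightarrow> 'a \<Rightarrow> 'a::real_vector set" where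
  "scale_operator c X x = (\<lambda>u. c *\<^sub>R u) ` X x"

definition inverse_operator :: "('a \<Rightarrow> 'b set) \<Rightarrow> 'b \<Rightarrow> 'a set" where
  "inverse_operator X y = {x. y \<in> X x}"

text \<open>
  The inverse of \<open>I + X\<close> as a map on points. It is meant for maximal monotone \<open>X\<close>, where the
  set-valued inverse is a singleton at every point; elsewhere the value of \<open>the_elem\<close>
  is unspecified.
\<close>

definition resolvent :: "('a \<Rightarrow> 'a set) \<Rightarrow> 'a \<Rightarrow> 'a::real_inner" where
  "resolvent X x = the_elem (inverse_operator (\<lambda>y. {y} + X y) x)"

definition douglas_rachford ::
  "real \<Rightarrow> ('a \<Rightarrow> 'a set) \<Rightarrow> ('a \<Rightarrow> 'a set) \<Rightarrow> 'a \<Rightarrow> 'a::real_inner" where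
  "douglas_rachford \<eta> A B x =
     resolvent (scale_operator \<eta> A) (2 *\<^sub>R resolvent (scale_operator \<eta> B) x - x)
     + x - resolvent (scale_operator \<eta> B) x"

definition gradient :: "('a \<Rightarrow> real) \<Rightarrow> 'a \<Rightarrow> 'a::real_inner" where
  "gradient f x = (THE D. GDERIV f x :> D)"

text \<open>
  The Fenchel conjugate as a real-valued function, hence meaningful only where the supremum
  is finite.
\<close>

definition conjugate :: "('a \<Rightarrow> real) \<Rightarrow> 'a::real_inner \<Rightarrow> real" where
  "conjugate h y = (SUP x. y \<bullet> x - h x)"

text \<open>
  The solution set of the variational inequality for \<open>\<Phi>\<close> when the constraint set is
  the whole space.
\<close>

definition SOL :: "('a \<Rightarrow> 'a set) \<Rightarrow> 'a::real_inner set" where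
  "SOL \<Phi> = {y. 0 \<in> \<Phi> y}"

text \<open>
  All values of \<open>\<alpha> (S (T x) - S x) - \<beta> \<Phi> x\<close>, where \<open>T\<close> and \<open>\<Phi>\<close> may be set-valued.
  For \<open>\<beta> = 0\<close> the last term is absent, also at points where \<open>\<Phi> x\<close> is empty; plain scaling
  by 0 would leave no value at such points.
\<close>

definition tmd_direction ::
  "real \<Rightarrow> real \<Rightarrow> ('a \<Rightarrow> 'a) \<Rightarrow> ('a \<Rightarrow> 'a set) \<Rightarrow> ('a \<Rightarrow> 'a set) \<Rightarrow> 'a \<Rightarrow> 'a::real_inner set" where
  "tmd_direction \<alpha> \<beta> S \<Phi> T x =
     {\<alpha> *\<^sub>R (S u - S x) - w |u w. u \<in> T x \<and> w \<in> (if \<beta> = 0 then {0} else scale_operator \<beta> \<Phi> x)}"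

definition tmd_iteration ::
  "('a \<Rightarrow> real) \<Rightarrow> real \<Rightarrow> real \<Rightarrow> ('a \<Rightarrow> 'a) \<Rightarrow> ('a \<Rightarrow> 'a set) \<Rightarrow> ('a \<Rightarrow> 'a set)
   \<Rightarrow> (nat \<Rightarrow> 'a::real_inner) \<Rightarrow> bool" where
  "tmd_iteration h \<alpha> \<beta> S \<Phi> T x \<longleftrightarrow>
     (\<forall>t. \<exists>d\<in>tmd_direction \<alpha> \<beta> S \<Phi> T (x t).
        x (Suc t) = gradient (conjugate h) (gradient h (x t) + d))"

text \<open>Classical solutions on the half-line; the derivative at 0 is one-sided.\<close>

definition tmd_solution ::
  "('a \<Rightarrow> real) \<Rightarrow> real \<Rightarrow> real \<Rightarrow> ('a \<Rightarrow> 'a) \<Rightarrow> ('a \<Rightarrow> 'a set) \<Rightarrow> ('a \<Rightarrow> 'a set)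
   \<Rightarrow> (real \<Rightarrow> 'a) \<Rightarrow> (real \<Rightarrow> 'a::real_inner) \<Rightarrow> bool" where
  "tmd_solution h \<alpha> \<beta> S \<Phi> T z x \<longleftrightarrow>
     (\<forall>t\<ge>0. x t = gradient (conjugate h) (z t) \<and>
        (\<exists>d\<in>tmd_direction \<alpha> \<beta> S \<Phi> T (x t). (z has_vector_derivative d) (at t within {0..})))"

end

theory Submission
  imports Defs
begin

text \<open>
  For \<open>h = \<parallel>\<cdot>\<parallel>\<^sup>2 / 2\<close> both \<open>\<nabla>h\<close> and \<open>\<nabla>h\<^sup>*\<close> are the identity, and
  \<open>S + \<Phi> = I + (T\<^sub>D\<^sub>R\<inverse> - I) = T\<^sub>D\<^sub>R\<inverse>\<close>, so that \<open>T\<close> is \<open>T\<^sub>D\<^sub>R\<close> again. The iteration therefore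
  reduces to \<open>x\<^sub>t\<^sub>+\<^sub>1 = T\<^sub>D\<^sub>R x\<^sub>t\<close> by cancellation, and the dynamics become the flow
  \<open>x' = T\<^sub>D\<^sub>R x - x\<close>. What remains is the convergence of this flow, which rests on two facts.

  The first is that \<open>T\<^sub>D\<^sub>R\<close> is firmly nonexpansive. Writing \<open>b\<close> and \<open>a\<close> for the two resolvent
  values computed at \<open>x\<close>, one has \<open>T\<^sub>D\<^sub>R x = a + x - b\<close>, and the inner product of increments
  of \<open>T\<^sub>D\<^sub>R x\<close> and \<open>x - T\<^sub>D\<^sub>R x = b - a\<close> is exactly the sum of the monotonicity expressions of the
  two operators. This needs the resolvents to be everywhere defined, which is Minty's
  theorem (\<open>minty_surjectivity\<close>). It is proved by minimizing one quadratic function over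
  the convex hull of the lifted graph \<open>(v, u, u \<bullet> v)\<close>; monotonicity makes this function
  nonnegative there, and the first-order condition along a minimizing sequence produces
  the required point.

  The second is the Lyapunov argument for a firmly nonexpansive \<open>F\<close> with a fixed point
  (\<open>firmly_nonexpansive_flow_converges\<close>). The squared distance of \<open>x\<close> to any fixed point
  decreases at rate at least \<open>2 \<parallel>x - F x\<parallel>\<^sup>2\<close>. Hence the residual \<open>x - F x\<close> becomes arbitrarily small
  along some times, and by compactness \<open>x\<close> has a cluster point \<open>q\<close>, which is fixed. The distance
  to \<open>q\<close> never increases and has \<open>0\<close> as a cluster value, so it tends to \<open>0\<close>.
\<close>

section \<open>Minty's theorem\<close>

text \<open>
  The inequality between the lifted coordinate and the inner product cannot be transferred
  to the hull directly, because \<open>u \<bullet> v\<close> is not convex. The monotonicity inequality for two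
  graph points, however, becomes affine in each of the two lifted points separately, so it
  passes to the hull one argument at a time; the claim is its diagonal.
\<close>

lemma monotone_hull_inner_le:
  fixes G :: "('a::real_inner \<times> 'a) set"
  assumes mono: "\<And>v u v' u'. (v, u) \<in> G \<Longrightarrow> (v', u') \<in> G \<Longrightarrow> (u - u') \<bullet> (v - v') \<ge> 0"
    and "(v, u, c) \<in> convex hull ((\<lambda>(v, u). (v, u, u \<bullet> v)) ` G)"
  shows "u \<bullet> v \<le> c"
proof -
  let ?P = "(\<lambda>(v, u). (v, u, u \<bullet> v)) ` G"
  let ?H = "\<lambda>v' u' c'. {(v, u, c). c - u \<bullet> v' - u' \<bullet> v + c' \<ge> 0}"
  have half: "convex (?H v' u' c')" for v' u' :: 'a and c' :: real
  proof (rule convexI)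
    fix s t :: real and p r
    assume st: "0 \<le> s" "0 \<le> t" "s + t = 1" and "p \<in> ?H v' u' c'" "r \<in> ?H v' u' c'"
    then obtain v1 u1 c1 v2 u2 c2 where pr: "p = (v1, u1, c1)" "r = (v2, u2, c2)"
      and 1: "0 \<le> c1 - u1 \<bullet> v' - u' \<bullet> v1 + c'" and 2: "0 \<le> c2 - u2 \<bullet> v' - u' \<bullet> v2 + c'"
      by auto
    have "0 \<le> s * (c1 - u1 \<bullet> v' - u' \<bullet> v1 + c') + t * (c2 - u2 \<bullet> v' - u' \<bullet> v2 + c')"
      using st 1 2 by simp
    also have "\<dots> = (s * c1 + t * c2) - (s *\<^sub>R u1 + t *\<^sub>R u2) \<bullet> v'
        - u' \<bullet> (s *\<^sub>R v1 + t *\<^sub>R v2) + (s + t) * c'"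
      by (simp add: inner_add_left inner_add_right algebra_simps)
    finally show "s *\<^sub>R p + t *\<^sub>R r \<in> ?H v' u' c'"
      using st pr by simp
  qed
  have graph: "?P \<subseteq> ?H v' u' (u' \<bullet> v')" if "(v', u') \<in> G" for v' u'
    using mono[OF _ that] by (force simp: inner_diff_left inner_diff_right algebra_simps)
  have "convex hull ?P \<subseteq> ?H v' u' (u' \<bullet> v')" if "(v', u') \<in> G" for v' u'
    using graph[OF that] half by (rule hull_minimal)
  then have "?P \<subseteq> ?H v u c"
    using assms(2) by (fastforce simp: inner_commute)
  then have "convex hull ?P \<subseteq> ?H v u c"
    using half by (rule hull_minimal)
  then have "(v, u, c) \<in> ?H v u c"
    using assms(2) by blast
  then show ?thesis by simp
qed

text \<open>
  With \<open>a = u - v\<close>, the point sought satisfies \<open>\<parallel>x\<parallel>\<^sup>2 + a \<bullet> x \<le> u \<bullet> v\<close> on the graph. This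
  follows from the first-order condition for minimizing \<open>q = \<parallel>a\<parallel>\<^sup>2 / 4 + c\<close> over the lifted hull,
  with \<open>x = - a / 2\<close> at the minimum, because the minimal value is nonnegative: on the hull
  \<open>q \<ge> \<parallel>u - v\<parallel>\<^sup>2 / 4 + u \<bullet> v = \<parallel>u + v\<parallel>\<^sup>2 / 4\<close>. The minimum need not be attained, nor need a
  minimizing sequence converge in \<open>(v, u, c)\<close>. But \<open>q\<close> is uniformly convex in \<open>a\<close>, so \<open>a\<close> is
  Cauchy along such a sequence; then \<open>c = q - \<parallel>a\<parallel>\<^sup>2 / 4\<close> converges as well, and the first-order
  condition involves only the limits of \<open>a\<close> and \<open>c\<close>.
\<close>

lemma monotone_relation_extension_point:
  fixes G :: "('a::{real_inner,complete_space} \<times> 'a) set"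
  assumes mono: "\<And>v u v' u'. (v, u) \<in> G \<Longrightarrow> (v', u') \<in> G \<Longrightarrow> (u - u') \<bullet> (v - v') \<ge> 0"
  obtains x where "\<And>v u. (v, u) \<in> G \<Longrightarrow> (x + u) \<bullet> (x - v) \<le> 0"
proof (cases "G = {}")
  case True
  then show ?thesis using that by blast
next
  case False
  define K where "K = convex hull ((\<lambda>(v, u). (v, u, u \<bullet> v)) ` G)"
  define a :: "'a \<times> 'a \<times> real \<Rightarrow> 'a" where "a = (\<lambda>(v, u, c). u - v)"
  define c :: "'a \<times> 'a \<times> real \<Rightarrow> real" where "c = (\<lambda>(v, u, c). c)"
  define q where "q p = (norm (a p))\<^sup>2 / 4 + c p" for p
  define m where "m = Inf (q ` K)"
  have K_ne: "K \<noteq> {}" and K_convex: "convex K"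
    using False by (auto simp: K_def)
  have a_comb: "a (s *\<^sub>R p + t *\<^sub>R r) = s *\<^sub>R a p + t *\<^sub>R a r"
    and c_comb: "c (s *\<^sub>R p + t *\<^sub>R r) = s * c p + t * c r" for s t p r
    by (auto simp: a_def c_def algebra_simps split: prod.splits)
  have q_nonneg: "q p \<ge> 0" if "p \<in> K" for p
  proof -
    obtain v u d where p: "p = (v, u, d)" by (cases p) auto
    have "u \<bullet> v \<le> d"
      using monotone_hull_inner_le[OF mono, of G v u d] that unfolding p K_def by blast
    moreover have "(norm (u - v))\<^sup>2 + 4 * (u \<bullet> v) = (norm (u + v))\<^sup>2"
      by (simp add: power2_norm_eq_inner inner_commute algebra_simps)
    ultimately show ?thesis
      using zero_le_power2[of "norm (u + v)"] unfolding p q_def a_def c_def prod.case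
      by linarith
  qed
  have bdd: "bdd_below (q ` K)"
    using q_nonneg by (auto intro!: bdd_belowI)
  have m_le: "m \<le> q p" if "p \<in> K" for p
    using cInf_lower[OF _ bdd] that by (auto simp: m_def)
  have m_nonneg: "0 \<le> m"
    unfolding m_def using K_ne q_nonneg by (intro cInf_greatest) auto
  have "\<exists>p\<in>K. q p < m + 1 / real (Suc k)" for k
    using cInf_lessD[of "q ` K" "m + 1 / real (Suc k)"] K_ne by (auto simp: m_def)
  then obtain p where p_K: "\<And>k. p k \<in> K" and p_le: "\<And>k. q (p k) < m + 1 / real (Suc k)"
    by metis
  have q_lim: "(\<lambda>k. q (p k)) \<longlonglongrightarrow> m"
  proof (rule tendsto_sandwich[OF _ _ tendsto_const])
    show "(\<lambda>k. m + 1 / real (Suc k)) \<longlonglongrightarrow> m"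
      using tendsto_add[OF tendsto_const LIMSEQ_inverse_real_of_nat, of m]
      by (simp add: inverse_eq_divide)
    show "\<forall>\<^sub>F k in sequentially. m \<le> q (p k)"
      by (simp add: m_le p_K)
    show "\<forall>\<^sub>F k in sequentially. q (p k) \<le> m + 1 / real (Suc k)"
      using p_le less_imp_le by (intro always_eventually) blast
  qed
  \<comment> \<open>The midpoint of two nearly optimal points cannot beat \<open>m\<close>.\<close>
  have close: "(norm (a (p k) - a (p l)))\<^sup>2 \<le> 8 * (1 / real (Suc k) + 1 / real (Suc l))" for k l
  proof -
    have "m \<le> q ((1/2) *\<^sub>R p k + (1/2) *\<^sub>R p l)"
      by (intro m_le convexD[OF K_convex] p_K) auto
    also have "\<dots> = (q (p k) + q (p l)) / 2 - (norm (a (p k) - a (p l)))\<^sup>2 / 16"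
      unfolding q_def a_comb c_comb
      by (simp add: power2_norm_eq_inner inner_commute algebra_simps add_divide_distrib
          diff_divide_distrib)
    finally show ?thesis using p_le[of k] p_le[of l] by argo
  qed
  have "Cauchy (\<lambda>k. a (p k))"
  proof (rule CauchyI)
    fix e :: real assume "0 < e"
    then obtain N where N: "1 / real (Suc N) < e\<^sup>2 / 16"
      using nat_approx_posE[of "e\<^sup>2 / 16"] by auto
    have "norm (a (p k) - a (p l)) < e" if "N \<le> k" "N \<le> l" for k l
    proof -
      have "1 / real (Suc k) \<le> 1 / real (Suc N)" "1 / real (Suc l) \<le> 1 / real (Suc N)"
        using that by (auto intro!: divide_left_mono)
      then have "(norm (a (p k) - a (p l)))\<^sup>2 < e\<^sup>2"
        using close[of k l] N by argo
      then show ?thesis using \<open>0 < e\<close> by (simp add: power_less_imp_less_base)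
    qed
    then show "\<exists>M. \<forall>k\<ge>M. \<forall>l\<ge>M. norm (a (p k) - a (p l)) < e" by blast
  qed
  then obtain w where w: "(\<lambda>k. a (p k)) \<longlonglongrightarrow> w"
    using Cauchy_convergent convergent_def by blast
  define d where "d = m - (norm w)\<^sup>2 / 4"
  have c_lim: "(\<lambda>k. c (p k)) \<longlonglongrightarrow> d"
  proof -
    have "(\<lambda>k. q (p k) - (norm (a (p k)))\<^sup>2 / 4) \<longlonglongrightarrow> d"
      unfolding d_def by (intro tendsto_intros q_lim w) simp
    then show ?thesis by (simp add: q_def)
  qed
  have first_order: "0 \<le> w \<bullet> (a r - w) / 2 + (c r - d)" if r: "r \<in> K" for r
  proof -
    define L where "L = w \<bullet> (a r - w) / 2 + (c r - d)"
    define Q where "Q = (norm (a r - w))\<^sup>2 / 4"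
    have step: "0 \<le> L + t * Q" if t: "0 < t" "t < 1" for t
    proof -
      have "m \<le> q (p k) + t * (a (p k) \<bullet> (a r - a (p k)) / 2 + (c r - c (p k)))
          + t\<^sup>2 * ((norm (a r - a (p k)))\<^sup>2 / 4)" for k
      proof -
        have "m \<le> q ((1 - t) *\<^sub>R p k + t *\<^sub>R r)"
          using t by (intro m_le convexD[OF K_convex] p_K r) auto
        also have "\<dots> = q (p k) + t * (a (p k) \<bullet> (a r - a (p k)) / 2 + (c r - c (p k)))
          + t\<^sup>2 * ((norm (a r - a (p k)))\<^sup>2 / 4)"
          unfolding q_def a_comb c_comb power2_norm_eq_inner
          by (simp add: inner_commute algebra_simps power2_eq_square
              add_divide_distrib diff_divide_distrib)
        finally show ?thesis .
      qed
      moreover have "(\<lambda>k. q (p k) + t * (a (p k) \<bullet> (a r - a (p k)) / 2 + (c r - c (p k)))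
          + t\<^sup>2 * ((norm (a r - a (p k)))\<^sup>2 / 4)) \<longlonglongrightarrow> m + t * L + t\<^sup>2 * Q"
        unfolding L_def Q_def by (intro tendsto_intros q_lim w c_lim) auto
      ultimately have "m \<le> m + t * L + t\<^sup>2 * Q"
        by (intro LIMSEQ_le_const) auto
      then have "0 \<le> t * (L + t * Q)" by (simp add: algebra_simps power2_eq_square)
      then show ?thesis using t by (simp add: zero_le_mult_iff)
    qed
    have "((\<lambda>t. L + t * Q) \<longlongrightarrow> L + 0 * Q) (at_right 0)"
      by (intro tendsto_intros)
    moreover have "eventually (\<lambda>t. 0 \<le> L + t * Q) (at_right (0::real))"
      using eventually_at_right_real[of 0 1] by (auto elim!: eventually_mono intro!: step)
    ultimately have "0 \<le> L"
      by (intro tendsto_lowerbound[of "\<lambda>t. L + t * Q"]) auto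
    then show ?thesis by (simp add: L_def)
  qed
  show ?thesis
  proof (rule that[of "- (1/2) *\<^sub>R w"])
    fix v u assume vu: "(v, u) \<in> G"
    then have "(v, u, u \<bullet> v) \<in> K"
      unfolding K_def by (intro hull_inc) force
    from first_order[OF this]
    have "0 \<le> w \<bullet> (u - v - w) / 2 + (u \<bullet> v - d)"
      by (simp add: a_def c_def)
    moreover have "(- (1/2) *\<^sub>R w + u) \<bullet> (- (1/2) *\<^sub>R w - v)
        = - (w \<bullet> (u - v - w) / 2 + (u \<bullet> v - d)) - m"
      by (simp add: d_def power2_norm_eq_inner inner_commute algebra_simps add_divide_distrib
          diff_divide_distrib)
    ultimately show "(- (1/2) *\<^sub>R w + u) \<bullet> (- (1/2) *\<^sub>R w - v) \<le> 0"
      using m_nonneg by linarith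
  qed
qed

text \<open>Adding a pair that is monotonically related to the whole graph keeps the operator monotone.\<close>

lemma maximal_monotone_memI:
  assumes max: "maximal_monotone X"
    and rel: "\<And>v u. u \<in> X v \<Longrightarrow> (w - u) \<bullet> (x - v) \<ge> 0"
  shows "w \<in> X x"
proof -
  have mono: "monotone_operator X" using max by (simp add: maximal_monotone_def)
  define Y where "Y = X(x := insert w (X x))"
  have "monotone_operator Y"
    unfolding monotone_operator_def
  proof (intro allI ballI)
    fix y y' u u' assume "u \<in> Y y" "u' \<in> Y y'"
    then consider "u \<in> X y" "u' \<in> X y'" | "y = x" "u = w" "u' \<in> X y'"
      | "u \<in> X y" "y' = x" "u' = w" | "y = x" "u = w" "y' = x" "u' = w"
      by (auto simp: Y_def split: if_splits)
    then show "0 \<le> (u - u') \<bullet> (y - y')"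
    proof cases
      case 1
      then show ?thesis using mono by (auto simp: monotone_operator_def)
    next
      case 2
      then show ?thesis using rel by simp
    next
      case 3
      have "(u - u') \<bullet> (y - y') = (u' - u) \<bullet> (y' - y)"
        by (simp add: algebra_simps inner_commute)
      with 3 rel show ?thesis by simp
    next
      case 4
      then show ?thesis by simp
    qed
  qed
  moreover have "\<forall>y. X y \<subseteq> Y y" by (auto simp: Y_def)
  ultimately have "Y = X" using max by (simp add: maximal_monotone_def)
  moreover have "w \<in> Y x" by (simp add: Y_def)
  ultimately show ?thesis by simp
qed

theorem minty_surjectivity:
  fixes X :: "'a::{real_inner,complete_space} \<Rightarrow> 'a set"
  assumes "maximal_monotone X"
  obtains x where "y - x \<in> X x"
proof -
  let ?G = "{(v, u). u + y \<in> X v}"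
  have mono: "(u - u') \<bullet> (v - v') \<ge> 0" if "(v, u) \<in> ?G" "(v', u') \<in> ?G" for v u v' u'
  proof -
    have "((u + y) - (u' + y)) \<bullet> (v - v') \<ge> 0"
      using assms that unfolding maximal_monotone_def monotone_operator_def by blast
    then show ?thesis by simp
  qed
  obtain x where x: "\<And>v u. (v, u) \<in> ?G \<Longrightarrow> (x + u) \<bullet> (x - v) \<le> 0"
    using monotone_relation_extension_point[OF mono] by blast
  have "y - x \<in> X x"
  proof (rule maximal_monotone_memI[OF assms])
    fix v u assume "u \<in> X v"
    then have "(x + (u - y)) \<bullet> (x - v) \<le> 0" by (intro x) simp
    then show "(y - x - u) \<bullet> (x - v) \<ge> 0" by (simp add: algebra_simps)
  qed
  then show ?thesis by (rule that)
qed

section \<open>Resolvents and the Douglas--Rachford operator\<close>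

lemma maximal_monotone_scale_operator:
  fixes X :: "'a::real_inner \<Rightarrow> 'a set"
  assumes max: "maximal_monotone X" and "\<eta> > 0"
  shows "maximal_monotone (scale_operator \<eta> X)"
  unfolding maximal_monotone_def
proof (intro conjI allI impI)
  have mono: "monotone_operator (scale_operator c Z)"
    if "monotone_operator Z" "0 < c" for c and Z :: "'a \<Rightarrow> 'a set"
    using that by (auto simp: monotone_operator_def scale_operator_def
        simp flip: scaleR_diff_right)
  show "monotone_operator (scale_operator \<eta> X)"
    using max \<open>\<eta> > 0\<close> by (intro mono) (simp_all add: maximal_monotone_def)
  fix Y :: "'a \<Rightarrow> 'a set"
  assume Y: "monotone_operator Y" "\<forall>x. scale_operator \<eta> X x \<subseteq> Y x"
  have "monotone_operator (scale_operator (inverse \<eta>) Y)"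
    using Y \<open>\<eta> > 0\<close> by (intro mono) simp_all
  moreover have "X x \<subseteq> scale_operator (inverse \<eta>) Y x" for x
  proof
    fix u assume "u \<in> X x"
    then have "\<eta> *\<^sub>R u \<in> Y x" using Y by (auto simp: scale_operator_def)
    then show "u \<in> scale_operator (inverse \<eta>) Y x"
      using \<open>\<eta> > 0\<close> by (force simp: scale_operator_def)
  qed
  ultimately have "scale_operator (inverse \<eta>) Y = X"
    using max by (simp add: maximal_monotone_def)
  then have "scale_operator \<eta> (scale_operator (inverse \<eta>) Y) = scale_operator \<eta> X" by simp
  moreover have "scale_operator \<eta> (scale_operator (inverse \<eta>) Y) = Y"
    using \<open>\<eta> > 0\<close> by (simp add: scale_operator_def image_image fun_eq_iff)
  ultimately show "Y = scale_operator \<eta> X" by simp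
qed

lemma resolvent_eqI:
  assumes "monotone_operator X" and "y - x \<in> X x"
  shows "resolvent X y = x"
proof -
  have unique: "x' = x" if "y - x' \<in> X x'" for x'
  proof -
    have "((y - x') - (y - x)) \<bullet> (x' - x) \<ge> 0"
      using assms that unfolding monotone_operator_def by blast
    then have "(norm (x' - x))\<^sup>2 \<le> 0"
      by (simp add: power2_norm_eq_inner algebra_simps inner_commute)
    then show ?thesis by simp
  qed
  have "y \<in> {x'} + X x' \<longleftrightarrow> y - x' \<in> X x'" for x'
    using bexI[of "\<lambda>u. y = x' + u" "y - x'" "X x'"] by (auto simp: set_plus_def)
  then have "inverse_operator (\<lambda>x. {x} + X x) y = {x'. y - x' \<in> X x'}"
    unfolding inverse_operator_def by blast
  also have "\<dots> = {x}" using assms(2) unique by blast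
  finally show ?thesis by (simp add: resolvent_def)
qed

lemma resolvent_mem:
  fixes X :: "'a::{real_inner,complete_space} \<Rightarrow> 'a set"
  assumes "maximal_monotone X"
  shows "y - resolvent X y \<in> X (resolvent X y)"
proof -
  obtain x where "y - x \<in> X x" using minty_surjectivity[OF assms] .
  moreover from this have "resolvent X y = x"
    using assms by (intro resolvent_eqI) (auto simp: maximal_monotone_def)
  ultimately show ?thesis by simp
qed

definition firmly_nonexpansive :: "('a::real_inner \<Rightarrow> 'a) \<Rightarrow> bool" where
  "firmly_nonexpansive F \<longleftrightarrow> (\<forall>x y. (F x - F y) \<bullet> ((x - F x) - (y - F y)) \<ge> 0)"

lemma resolvent_firmly_nonexpansive:
  fixes X :: "'a::{real_inner,complete_space} \<Rightarrow> 'a set"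
  assumes "maximal_monotone X"
  shows "firmly_nonexpansive (resolvent X)"
proof -
  have "monotone_operator X" using assms by (simp add: maximal_monotone_def)
  then show ?thesis
    using resolvent_mem[OF assms]
    by (auto simp: firmly_nonexpansive_def monotone_operator_def inner_commute)
qed

lemma douglas_rachford_firmly_nonexpansive:
  fixes A B :: "'a::{real_inner,complete_space} \<Rightarrow> 'a set"
  assumes "maximal_monotone A" "maximal_monotone B" "\<eta> > 0"
  shows "firmly_nonexpansive (douglas_rachford \<eta> A B)"
  unfolding firmly_nonexpansive_def
proof (intro allI)
  fix x y
  let ?JA = "resolvent (scale_operator \<eta> A)" and ?JB = "resolvent (scale_operator \<eta> B)"
  define b b' where "b = ?JB x" and "b' = ?JB y"
  define a a' where "a = ?JA (2 *\<^sub>R b - x)" and "a' = ?JA (2 *\<^sub>R b' - y)"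
  have JA: "firmly_nonexpansive ?JA" and JB: "firmly_nonexpansive ?JB"
    using assms by (auto intro: resolvent_firmly_nonexpansive maximal_monotone_scale_operator)
  have B: "0 \<le> (b - b') \<bullet> ((x - b) - (y - b'))"
    using JB by (simp add: firmly_nonexpansive_def b_def b'_def)
  have A: "0 \<le> (a - a') \<bullet> ((2 *\<^sub>R b - x - a) - (2 *\<^sub>R b' - y - a'))"
    using JA by (simp add: firmly_nonexpansive_def a_def a'_def)
  have T: "douglas_rachford \<eta> A B x = a + x - b" "douglas_rachford \<eta> A B y = a' + y - b'"
    by (simp_all add: douglas_rachford_def a_def a'_def b_def b'_def)
  have identity: "(e + z - f) \<bullet> (z - (e + z - f)) = f \<bullet> (z - f) + e \<bullet> (2 *\<^sub>R f - z - e)" for e f z :: 'a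
    by (simp add: algebra_simps inner_commute)
  show "0 \<le> (douglas_rachford \<eta> A B x - douglas_rachford \<eta> A B y) \<bullet>
      ((x - douglas_rachford \<eta> A B x) - (y - douglas_rachford \<eta> A B y))"
    using A B identity[of "a - a'" "x - y" "b - b'"] unfolding T
    by (simp add: algebra_simps)
qed

text \<open>
  If \<open>u \<in> A x\<close> and \<open>- u \<in> B x\<close>, then \<open>x - \<eta> u\<close> is a fixed point: both resolvents involved
  take the value \<open>x\<close>.
\<close>

lemma douglas_rachford_fixed_point:
  fixes A B :: "'a::real_inner \<Rightarrow> 'a set"
  assumes "maximal_monotone A" "maximal_monotone B" "\<eta> > 0" and "0 \<in> A x + B x"
  obtains y where "douglas_rachford \<eta> A B y = y"
proof -
  obtain u v where uv: "u \<in> A x" "v \<in> B x" "0 = u + v"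
    using assms(4) by (auto elim: set_plus_elim)
  have v: "v = - u" using uv(3) by (simp add: eq_neg_iff_add_eq_0 add.commute)
  have mono: "monotone_operator (scale_operator \<eta> A)" "monotone_operator (scale_operator \<eta> B)"
    using assms maximal_monotone_scale_operator by (auto simp: maximal_monotone_def)
  have JB: "resolvent (scale_operator \<eta> B) (x - \<eta> *\<^sub>R u) = x"
    using uv v by (intro resolvent_eqI mono) (force simp: scale_operator_def)
  have JA: "resolvent (scale_operator \<eta> A) (x + \<eta> *\<^sub>R u) = x"
    using uv by (intro resolvent_eqI mono) (force simp: scale_operator_def)
  have reflected: "2 *\<^sub>R x - (x - \<eta> *\<^sub>R u) = x + \<eta> *\<^sub>R u" by (simp add: scaleR_2)
  have "douglas_rachford \<eta> A B (x - \<eta> *\<^sub>R u) = x - \<eta> *\<^sub>R u"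
    unfolding douglas_rachford_def JB reflected JA by simp
  then show ?thesis by (rule that)
qed

section \<open>Flows of firmly nonexpansive maps\<close>

lemma firmly_nonexpansive_norm_le:
  assumes "firmly_nonexpansive F"
  shows "norm (F x - F y) \<le> norm (x - y)"
proof -
  have "(norm (F x - F y))\<^sup>2 \<le> (F x - F y) \<bullet> (x - y)"
    using assms[unfolded firmly_nonexpansive_def, rule_format, of x y]
    by (simp add: power2_norm_eq_inner algebra_simps inner_commute)
  also have "\<dots> \<le> norm (F x - F y) * norm (x - y)" by (rule norm_cauchy_schwarz)
  finally show ?thesis
    by (cases "F x = F y") (auto simp: power2_eq_square)
qed

lemma firmly_nonexpansive_continuous:
  assumes "firmly_nonexpansive F"
  shows "continuous_on UNIV F"
proof -
  have "1-lipschitz_on UNIV F"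
    using firmly_nonexpansive_norm_le[OF assms] by (auto simp: lipschitz_on_def dist_norm)
  then show ?thesis by (rule lipschitz_on_continuous_on)
qed

lemma firmly_nonexpansive_fixed_point_inner:
  assumes "firmly_nonexpansive F" "F p = p"
  shows "(x - p) \<bullet> (F x - x) \<le> - (norm (F x - x))\<^sup>2"
  using assms(1)[unfolded firmly_nonexpansive_def, rule_format, of x p] assms(2)
  by (simp add: power2_norm_eq_inner algebra_simps inner_commute)

text \<open>
  The Lyapunov estimate in the form used twice below: with \<open>e = 0\<close> it says that the distance
  to a fixed point never increases, and with \<open>e > 0\<close> it excludes a residual that stays above \<open>e\<close>.
\<close>

lemma flow_distance_decreases:
  fixes x :: "real \<Rightarrow> 'a::real_inner"
  assumes F: "firmly_nonexpansive F" "F p = p"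
    and deriv: "\<And>t. t \<ge> 0 \<Longrightarrow> (x has_vector_derivative (F (x t) - x t)) (at t within {0..})"
    and "0 \<le> s" "s \<le> t" "0 \<le> e"
    and residual: "\<And>r. s \<le> r \<Longrightarrow> e \<le> norm (F (x r) - x r)"
  shows "(norm (x t - p))\<^sup>2 \<le> (norm (x s - p))\<^sup>2 - 2 * e\<^sup>2 * (t - s)"
proof (cases "s = t")
  case False
  then have "s < t" using \<open>s \<le> t\<close> by simp
  let ?f = "\<lambda>r. (x r - p) \<bullet> (x r - p)"
  let ?D = "\<lambda>r k. (x r - p) \<bullet> (k *\<^sub>R (F (x r) - x r)) + (k *\<^sub>R (F (x r) - x r)) \<bullet> (x r - p)"
  have "(?f has_derivative ?D r) (at r within {s..t})" if "s \<le> r" "r \<le> t" for r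
  proof -
    have "(x has_derivative (\<lambda>k. k *\<^sub>R (F (x r) - x r))) (at r within {s..t})"
      using deriv[of r] that \<open>0 \<le> s\<close>
      unfolding has_vector_derivative_def
      by (auto intro: has_derivative_subset[where s = "{0..}"])
    then show ?thesis by (auto intro!: derivative_eq_intros)
  qed
  from mvt_simple[OF \<open>s < t\<close> this]
  obtain r where r: "r \<in> {s<..<t}" and eq: "?f t - ?f s = ?D r (t - s)" by blast
  have "e\<^sup>2 \<le> (norm (F (x r) - x r))\<^sup>2"
    using residual[of r] r \<open>0 \<le> e\<close> by (intro power_mono) auto
  then have "(x r - p) \<bullet> (F (x r) - x r) \<le> - e\<^sup>2"
    using firmly_nonexpansive_fixed_point_inner[OF F, of "x r"] by linarith
  then have "(t - s) * ((x r - p) \<bullet> (F (x r) - x r)) \<le> (t - s) * (- e\<^sup>2)"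
    using \<open>s < t\<close> by (intro mult_left_mono) auto
  moreover have "?D r (t - s) = 2 * ((t - s) * ((x r - p) \<bullet> (F (x r) - x r)))"
    by (simp add: inner_commute)
  ultimately show ?thesis
    using eq by (simp add: power2_norm_eq_inner algebra_simps)
qed simp

theorem firmly_nonexpansive_flow_converges:
  fixes x :: "real \<Rightarrow> 'a::euclidean_space"
  assumes F: "firmly_nonexpansive F" and p: "F p = p"
    and deriv: "\<And>t. t \<ge> 0 \<Longrightarrow> (x has_vector_derivative (F (x t) - x t)) (at t within {0..})"
  obtains q where "F q = q" "(x \<longlongrightarrow> q) at_top"
proof -
  have decr: "norm (x t - q) \<le> norm (x s - q)" if "F q = q" "0 \<le> s" "s \<le> t" for q s t
  proof -
    have "(norm (x t - q))\<^sup>2 \<le> (norm (x s - q))\<^sup>2"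
      using flow_distance_decreases[OF F \<open>F q = q\<close> deriv, of s t 0] that by simp
    then show ?thesis by (rule power2_le_imp_le) simp
  qed
  have small: "\<exists>t\<ge>0. norm (F (x t) - x t) < e" if "0 < e" for e
  proof (rule ccontr)
    assume "\<not> ?thesis"
    then have "\<And>r. 0 \<le> r \<Longrightarrow> e \<le> norm (F (x r) - x r)" by force
    \<comment> \<open>The time at which the guaranteed decrease would exceed the initial squared distance.\<close>
    define t where "t = ((norm (x 0 - p))\<^sup>2 + 1) / (2 * e\<^sup>2)"
    have "0 \<le> t" using \<open>0 < e\<close> by (auto simp: t_def)
    then have "(norm (x t - p))\<^sup>2 \<le> (norm (x 0 - p))\<^sup>2 - 2 * e\<^sup>2 * (t - 0)"
      using \<open>0 < e\<close> \<open>\<And>r. 0 \<le> r \<Longrightarrow> e \<le> norm (F (x r) - x r)\<close>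
      by (intro flow_distance_decreases[OF F p deriv]) auto
    also have "2 * e\<^sup>2 * (t - 0) = (norm (x 0 - p))\<^sup>2 + 1"
      using \<open>0 < e\<close> by (simp add: t_def)
    finally show False using zero_le_power2[of "norm (x t - p)"] by linarith
  qed
  then have "\<forall>k. \<exists>t\<ge>0. norm (F (x t) - x t) < inverse (real (Suc k))" by simp
  from choice[OF this] obtain \<tau>
    where \<tau>: "\<And>k. 0 \<le> \<tau> k" "\<And>k. norm (F (x (\<tau> k)) - x (\<tau> k)) < inverse (real (Suc k))"
    by blast
  have res: "(\<lambda>k. F (x (\<tau> k)) - x (\<tau> k)) \<longlonglongrightarrow> 0"
    by (rule Lim_null_comparison[OF always_eventually LIMSEQ_inverse_real_of_nat])
       (blast intro: less_imp_le \<tau>(2))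
  have "\<forall>k. x (\<tau> k) \<in> cball p (norm (x 0 - p))"
    using decr[OF p, of 0] \<tau>(1) by (simp add: dist_norm norm_minus_commute)
  then obtain q \<rho> where \<rho>: "strict_mono \<rho>" and q: "((\<lambda>k. x (\<tau> k)) \<circ> \<rho>) \<longlonglongrightarrow> q"
    using seq_compactE[OF compact_imp_seq_compact[OF compact_cball]] by metis
  have "(\<lambda>k. F (((\<lambda>k. x (\<tau> k)) \<circ> \<rho>) k)) \<longlonglongrightarrow> F q"
    by (rule continuous_on_tendsto_compose[OF firmly_nonexpansive_continuous[OF F] q]) auto
  from tendsto_diff[OF this q]
  have "((\<lambda>k. F (x (\<tau> k)) - x (\<tau> k)) \<circ> \<rho>) \<longlonglongrightarrow> F q - q" by (simp add: o_def)
  then have "F q - q = 0"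
    using LIMSEQ_subseq_LIMSEQ[OF res \<rho>] LIMSEQ_unique by blast
  then have q_fixed: "F q = q" by simp
  have "(x \<longlongrightarrow> q) at_top"
  proof (rule tendstoI)
    fix e :: real assume "0 < e"
    then have "eventually (\<lambda>k. dist (((\<lambda>k. x (\<tau> k)) \<circ> \<rho>) k) q < e) sequentially"
      using q by (rule tendstoD[rotated])
    then obtain k where k: "dist (x (\<tau> (\<rho> k))) q < e"
      by (auto simp: eventually_sequentially)
    have "dist (x t) q < e" if "\<tau> (\<rho> k) \<le> t" for t
      using decr[OF q_fixed \<tau>(1) that] k by (simp add: dist_norm)
    then show "eventually (\<lambda>t. dist (x t) q < e) at_top"
      by (auto intro: eventually_at_top_linorderI)
  qed
  with q_fixed show ?thesis by (rule that)
qed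

section \<open>Reduction of the dynamics to the Douglas--Rachford operator\<close>

lemma gradient_half_norm_square:
  "gradient (\<lambda>x::'a::real_inner. (norm x)\<^sup>2 / 2) = (\<lambda>x. x)"
proof
  fix x :: 'a
  have "((\<lambda>x. (x \<bullet> x) / 2) has_derivative (\<lambda>k. k \<bullet> x)) (at x)"
    by (auto intro!: derivative_eq_intros simp: inner_commute)
  then have "GDERIV (\<lambda>x. (norm x)\<^sup>2 / 2) x :> x"
    by (simp add: gderiv_def power2_norm_eq_inner)
  moreover from this have "D = x" if "GDERIV (\<lambda>x. (norm x)\<^sup>2 / 2) x :> D" for D
  proof -
    have "(\<lambda>k. k \<bullet> D) = (\<lambda>k. k \<bullet> x)"
      using that calculation unfolding gderiv_def by (rule has_derivative_unique)
    then have "\<And>k. k \<bullet> D = k \<bullet> x" by (rule fun_cong)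
    then show ?thesis by (metis inner_commute vector_eq_rdot)
  qed
  ultimately show "gradient (\<lambda>x. (norm x)\<^sup>2 / 2) x = x"
    unfolding gradient_def by (rule the_equality)
qed

lemma conjugate_half_norm_square:
  "conjugate (\<lambda>x::'a::real_inner. (norm x)\<^sup>2 / 2) = (\<lambda>x. (norm x)\<^sup>2 / 2)"
proof
  fix y :: 'a
  have "y \<bullet> x - (norm x)\<^sup>2 / 2 \<le> (norm y)\<^sup>2 / 2" for x
    using zero_le_power2[of "norm (y - x)"]
    by (simp add: power2_norm_eq_inner algebra_simps inner_commute)
  moreover have "y \<bullet> y - (norm y)\<^sup>2 / 2 = (norm y)\<^sup>2 / 2"
    by (simp add: power2_norm_eq_inner)
  ultimately show "conjugate (\<lambda>x. (norm x)\<^sup>2 / 2) y = (norm y)\<^sup>2 / 2"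
    unfolding conjugate_def by (intro cSup_eq_maximum range_eqI[where x = y]) auto
qed

lemma inverse_translated_inverse:
  fixes F :: "'a::ab_group_add \<Rightarrow> 'a"
  shows "inverse_operator (\<lambda>y. {y} + (inverse_operator (\<lambda>x. {F x}) y + {- y})) x = {F x}"
  by (force simp: inverse_operator_def set_plus_def)

theorem proposition3:
  fixes A B :: "real ^ 'n \<Rightarrow> (real ^ 'n) set"
    and \<eta> \<alpha> \<beta> :: real
    and T\<^sub>D\<^sub>R S :: "real ^ 'n \<Rightarrow> real ^ 'n"
    and h :: "real ^ 'n \<Rightarrow> real"
    and \<Phi> T :: "real ^ 'n \<Rightarrow> (real ^ 'n) set"
  assumes "maximal_monotone A" and "maximal_monotone B"
    and "\<exists>x. 0 \<in> A x + B x"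
    and "\<eta> > 0"
    and "T\<^sub>D\<^sub>R = douglas_rachford \<eta> A B"
    and "h = (\<lambda>x. (norm x)\<^sup>2 / 2)"
    and "\<alpha> = 1" and "\<beta> = 0"
    and "S = (\<lambda>x. x)"
    and "\<Phi> = (\<lambda>y. inverse_operator (\<lambda>x. {T\<^sub>D\<^sub>R x}) y + {- y})"
    and "T = inverse_operator (\<lambda>y. {S y} + \<Phi> y) \<circ> S"
  shows "(\<forall>x. tmd_iteration h \<alpha> \<beta> S \<Phi> T x \<longleftrightarrow> (\<forall>t. x (Suc t) = T\<^sub>D\<^sub>R (x t))) \<and>
    (\<forall>z x. tmd_solution h \<alpha> \<beta> S \<Phi> T z x \<longrightarrow>
       (\<exists>p\<in>SOL \<Phi>. T\<^sub>D\<^sub>R p = p \<and> (x \<longlongrightarrow> p) at_top))"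
proof -
  have grad: "gradient h = (\<lambda>x. x)" "gradient (conjugate h) = (\<lambda>x. x)"
    using assms(6) by (simp_all add: conjugate_half_norm_square gradient_half_norm_square)
  have "T x = {T\<^sub>D\<^sub>R x}" for x
    using assms(9-11) by (simp add: inverse_translated_inverse)
  then have dir: "tmd_direction \<alpha> \<beta> S \<Phi> T x = {T\<^sub>D\<^sub>R x - x}" for x
    using assms(7-9) by (simp add: tmd_direction_def)
  have firm: "firmly_nonexpansive T\<^sub>D\<^sub>R"
    using assms(1,2,4,5) douglas_rachford_firmly_nonexpansive by blast
  obtain p where p: "T\<^sub>D\<^sub>R p = p"
    using assms(1-5) douglas_rachford_fixed_point by metis
  have "tmd_iteration h \<alpha> \<beta> S \<Phi> T x \<longleftrightarrow> (\<forall>t. x (Suc t) = T\<^sub>D\<^sub>R (x t))" for x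
    by (simp add: tmd_iteration_def grad dir)
  moreover have "\<exists>p\<in>SOL \<Phi>. T\<^sub>D\<^sub>R p = p \<and> (x \<longlongrightarrow> p) at_top"
    if "tmd_solution h \<alpha> \<beta> S \<Phi> T z x" for z x
  proof -
    have xz: "x t = z t" and "(z has_vector_derivative (T\<^sub>D\<^sub>R (z t) - z t)) (at t within {0..})"
      if "0 \<le> t" for t
      using \<open>tmd_solution h \<alpha> \<beta> S \<Phi> T z x\<close> that by (auto simp: tmd_solution_def grad dir)
    then obtain q where q: "T\<^sub>D\<^sub>R q = q" "(z \<longlongrightarrow> q) at_top"
      using firmly_nonexpansive_flow_converges[OF firm p] by metis
    have "eventually (\<lambda>t. z t = x t) at_top"
      using eventually_ge_at_top[of 0] by (rule eventually_mono) (simp add: xz)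
    with q(2) have "(x \<longlongrightarrow> q) at_top" by (rule Lim_transform_eventually)
    moreover have "q \<in> SOL \<Phi>"
    proof -
      have "q \<in> inverse_operator (\<lambda>x. {T\<^sub>D\<^sub>R x}) q" using q(1) by (simp add: inverse_operator_def)
      then have "q + - q \<in> \<Phi> q" unfolding assms(10) by (intro set_plus_intro) auto
      then show ?thesis by (simp add: SOL_def)
    qed
    ultimately show ?thesis using q(1) by blast
  qed
  ultimately show ?thesis by blast
qed

end
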